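(* Let $L_1,S_1,L_2,S_2$ be integers with $L_i> S_i-1\geq 0$ for $i=1,2$, and let $\beta_i\in(0,1)$ be the unique positive number with $L_i\beta_i+S_i\beta_i^2=1$. Assume that there exist non-negative integers $k$ and $m$ such that $\beta_1^{k+1}/\beta_2^{m+1}\in\mathbb{Q}$. Then the two-dimensional sequence $\big(\xi_{L_1,S_1}^n,\xi_{L_2,S_2}^n\big)_{n\ge 0}$ is not uniformly distributed modulo 1; in fact it is not even dense in $[0,1]^2$.
   Context: LS-sequence of points. Let $L\ge 1$, $S\ge 0$ be integers with $L+S\ge 2$, and let $\beta\in(0,1)$ be the unique positive solution of $L\beta+S\beta^2=1$. Define integer sequences by $t_0=1$, $t_1=L+S$, $l_0=1$, $l_1=L$ and $t_n=Lt_{n-1}+St_{n-2}$, $l_n=Ll_{n-1}+Sl_{n-2}$ for $n\ge 2$. The LS-sequence of points $(\xi_{L,S}^N)_{N\ge 0}$ in $[0,1)$ is defined recursively: $\xi_{L,S}^0=0$, and for $n\ge 0$ and $t_n\le N<t_{n+1}$, write uniquely $N=t_n+\eta l_n+r$ with integers $0\le \eta\le L+S-2$ and $0\le r<l_n$, and set $$\xi_{L,S}^N=\xi_{L,S}^r+\beta^{n+1}\min\{L,\eta+1\}+\beta^{n+2}\max\{\eta+1-L,0\}.$$ (Equivalently: the points with indices $<t_n$ are the left endpoints of the $n$-th partition obtained by repeatedly splitting every interval of maximal length homothetically into $L$ intervals of relative length $\beta$ followed by $S$ intervals of relative length $\beta^2$; at each step the new left endpoints are appended, for each of the $L+S-1$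 new relative positions in increasing order, shifting in turn all the old left endpoints $\xi^0,\dots,\xi^{l_n-1}$ of the long intervals.) A sequence $(y_n)$ in $[0,1)^d$ is uniformly distributed modulo 1 if for all $0\le a<b\le 1$ (coordinatewise) the proportion of $n\le N$ with $y_n\in[a,b)$ tends to the volume of the box $[a,b)$ as $N\to\infty$. *)

theory Defs
  imports "HOL-Analysis.Analysis"
begin

fun ls_t :: "nat \<Rightarrow> nat \<Rightarrow> nat \<Rightarrow> nat" where
  "ls_t L S 0 = 1"
| "ls_t L S (Suc 0) = L + S"
| "ls_t L S (Suc (Suc n)) = L * ls_t L S (Suc n) + S * ls_t L S n"

fun ls_l :: "nat \<Rightarrow> nat \<Rightarrow> nat \<Rightarrow> nat" where
  "ls_l L S 0 = 1"
| "ls_l L S (Suc 0) = L"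
| "ls_l L S (Suc (Suc n)) = L * ls_l L S (Suc n) + S * ls_l L S n"

definition ls_beta :: "nat \<Rightarrow> nat \<Rightarrow> real" where
  "ls_beta L S = (THE \<beta>. 0 < \<beta> \<and> real L * \<beta> + real S * \<beta>\<^sup>2 = 1)"

lemma ls_beta_ex1:
  assumes "L \<ge> 1"
  shows "\<exists>!\<beta>::real. 0 < \<beta> \<and> real L * \<beta> + real S * \<beta>\<^sup>2 = 1"
proof (rule ex_ex1I)
  have "\<exists>x::real. 0 \<le> x \<and> x \<le> 1 \<and> real L * x + real S * x\<^sup>2 = 1"
    by (rule IVT') (use assms in \<open>auto intro!: continuous_intros\<close>)
  then obtain x :: real where x: "0 \<le> x" "real L * x + real S * x\<^sup>2 = 1" by blast
  have "x \<noteq> 0" using x(2) by (intro notI) simp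
  with x(1) have "0 < x" by simp
  with x(2) show "\<exists>\<beta>::real. 0 < \<beta> \<and> real L * \<beta> + real S * \<beta>\<^sup>2 = 1" by blast
next
  have *: False if "0 < x" "x < y" "real L * x + real S * x\<^sup>2 = 1"
    "real L * y + real S * y\<^sup>2 = 1" for x y :: real
  proof -
    have "real L * x < real L * y" using that(2) assms by (intro mult_strict_left_mono) auto
    moreover have "x\<^sup>2 \<le> y\<^sup>2" using that(1,2) by (intro power_mono) auto
    hence "real S * x\<^sup>2 \<le> real S * y\<^sup>2" by (intro mult_left_mono) auto
    ultimately show False using that(3,4) by linarith
  qed
  fix x y :: real
  assume "0 < x \<and> real L * x + real S * x\<^sup>2 = 1" "0 < y \<and> real L * y + real S * y\<^sup>2 = 1"
  with *[of x y] *[of y x] show "x = y" by (meson linorder_less_linear)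
qed

lemma ls_beta:
  assumes "L \<ge> 1"
  shows ls_beta_pos: "0 < ls_beta L S"
    and ls_beta_eq: "real L * ls_beta L S + real S * (ls_beta L S)\<^sup>2 = 1"
  using theI'[OF ls_beta_ex1[OF assms, of S]] unfolding ls_beta_def by auto

lemma ls_beta_less_1:
  assumes "L \<ge> 1" "L + S \<ge> 2"
  shows "ls_beta L S < 1"
proof (rule ccontr)
  assume "\<not> ?thesis"
  hence b: "ls_beta L S \<ge> 1" by simp
  hence "(ls_beta L S)\<^sup>2 \<ge> 1" by simp
  hence "real L * 1 + real S * 1 \<le> real L * ls_beta L S + real S * (ls_beta L S)\<^sup>2"
    using b by (intro add_mono mult_left_mono) auto
  thus False using ls_beta_eq[OF assms(1), of S] assms(2) by linarith
qed

lemma ls_t_pos: "L \<ge> 1 \<Longrightarrow> ls_t L S n > 0"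
  by (induction L S n rule: ls_t.induct) auto

lemma ls_l_pos: "L \<ge> 1 \<Longrightarrow> ls_l L S n > 0"
  by (induction L S n rule: ls_l.induct) auto

lemma ls_t_Suc:
  assumes "L \<ge> 1"
  shows "ls_t L S (Suc n) = ls_t L S n + (L + S - 1) * ls_l L S n"
proof -
  define c where "c = L + S - 1"
  have c: "L + S = Suc c" using assms by (simp add: c_def)
  have "ls_t L S (Suc n) = ls_t L S n + c * ls_l L S n
      \<and> ls_t L S (Suc (Suc n)) = ls_t L S (Suc n) + c * ls_l L S (Suc n)"
  proof (induction n)
    case 0
    have "L * (L + S) + S = (L + S) + c * L" unfolding c using c by (simp add: algebra_simps)
    thus ?case using c by simp
  next
    case (Suc n)
    have "ls_t L S (Suc (Suc (Suc n))) = L * ls_t L S (Suc (Suc n)) + S * ls_t L S (Suc n)"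
      by (rule ls_t.simps)
    also have "\<dots> = L * (ls_t L S (Suc n) + c * ls_l L S (Suc n)) + S * (ls_t L S n + c * ls_l L S n)"
      using Suc.IH by (simp only:)
    also have "\<dots> = ls_t L S (Suc (Suc n)) + c * ls_l L S (Suc (Suc n))"
      unfolding ls_t.simps ls_l.simps by (simp only: algebra_simps)
    finally show ?case using Suc.IH by blast
  qed
  thus ?thesis by (simp only: c_def)
qed

lemma ls_t_strict_mono:
  assumes "L \<ge> 1" "L + S \<ge> 2"
  shows "strict_mono (ls_t L S)"
proof -
  have "ls_t L S n < ls_t L S (Suc n)" for n
    unfolding ls_t_Suc[OF assms(1)] using assms ls_l_pos[OF assms(1), of S n] by simp
  thus ?thesis by (simp add: strict_mono_Suc_iff)
qed

definition ls_level :: "nat \<Rightarrow> nat \<Rightarrow> nat \<Rightarrow> nat" where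
  "ls_level L S N = (THE n. ls_t L S n \<le> N \<and> N < ls_t L S (n + 1))"

lemma ls_level_eqI:
  assumes "L \<ge> 1" "L + S \<ge> 2" "ls_t L S n \<le> N" "N < ls_t L S (n + 1)"
  shows "ls_level L S N = n"
  unfolding ls_level_def
proof (rule the_equality)
  fix m assume m: "ls_t L S m \<le> N \<and> N < ls_t L S (m + 1)"
  from m assms have "ls_t L S m < ls_t L S (n + 1)" "ls_t L S n < ls_t L S (m + 1)" by auto
  thus "m = n"
    using strict_mono_less[OF ls_t_strict_mono[OF assms(1,2)]] by auto
qed (use assms in auto)

lemma ls_level_ex:
  assumes "L \<ge> 1" "L + S \<ge> 2" "N \<ge> 1"
  shows "ls_t L S (ls_level L S N) \<le> N" "N < ls_t L S (ls_level L S N + 1)"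
proof -
  have "N < ls_t L S (Suc N)"
    using strict_mono_imp_increasing[OF ls_t_strict_mono[OF assms(1,2)], of "Suc N"] by simp
  then obtain n where "\<forall>i<n. \<not> N < ls_t L S i" "N < ls_t L S n"
    using exists_least_iff[of "\<lambda>n. N < ls_t L S n"] by auto
  note n = this
  obtain m where m: "n = Suc m" using n(2) assms(3) by (cases n) auto
  have *: "ls_t L S m \<le> N" "N < ls_t L S (m + 1)" using n m by (auto simp: not_less)
  have "ls_level L S N = m" by (rule ls_level_eqI[OF assms(1,2) *])
  with * show "ls_t L S (ls_level L S N) \<le> N" "N < ls_t L S (ls_level L S N + 1)" by simp_all
qed

text \<open>For \<open>t\<^sub>n \<le> N < t\<^bsub>n+1\<^esub>\<close> the digits \<open>\<eta>\<close> and \<open>r\<close> are the quotient and the remainder of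
  \<open>N - t\<^sub>n\<close> by \<open>l\<^sub>n\<close>; see \<open>ls_point_rec\<close> and \<open>ls_decomp\<close> below. The case \<open>L = 0\<close> is junk
  that makes the recursion terminate unconditionally.\<close>

function ls_point :: "nat \<Rightarrow> nat \<Rightarrow> nat \<Rightarrow> real" where
  "ls_point L S N =
    (if N = 0 \<or> L = 0 then 0
     else let n = ls_level L S N;
              \<eta> = (N - ls_t L S n) div ls_l L S n;
              r = (N - ls_t L S n) mod ls_l L S n
          in ls_point L S r
             + ls_beta L S ^ (n + 1) * min (real L) (real \<eta> + 1)
             + ls_beta L S ^ (n + 2) * max (real \<eta> + 1 - real L) 0)"
  by auto
termination
proof (relation "Wellfounded.measure (\<lambda>(L, S, N). N)"; clarsimp)
  fix L S N :: nat
  assume "0 < L" "0 < N"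
  have "(N - ls_t L S (ls_level L S N)) mod ls_l L S (ls_level L S N)
      \<le> N - ls_t L S (ls_level L S N)" by (rule mod_less_eq_dividend)
  also have "\<dots> < N" using ls_t_pos[of L S "ls_level L S N"] \<open>0 < L\<close> \<open>0 < N\<close> by simp
  finally show "(N - ls_t L S (ls_level L S N)) mod ls_l L S (ls_level L S N) < N" .
qed

declare ls_point.simps [simp del]

lemma ls_point_0: "ls_point L S 0 = 0"
  by (simp add: ls_point.simps)

lemma ls_point_rec:
  assumes "L \<ge> 1" "L + S \<ge> 2" "ls_t L S n \<le> N" "N < ls_t L S (n + 1)"
    and N: "N = ls_t L S n + \<eta> * ls_l L S n + r" and r: "r < ls_l L S n"
  shows "ls_point L S N = ls_point L S r
      + ls_beta L S ^ (n + 1) * min (real L) (real \<eta> + 1)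
      + ls_beta L S ^ (n + 2) * max (real \<eta> + 1 - real L) 0"
proof -
  have "N \<noteq> 0" using ls_t_pos[OF assms(1), of S n] assms(3) by simp
  moreover have "(N - ls_t L S n) div ls_l L S n = \<eta>" "(N - ls_t L S n) mod ls_l L S n = r"
    using N r by auto
  ultimately show ?thesis
    using ls_level_eqI[OF assms(1-4)] assms(1)
    by (subst ls_point.simps) (simp add: Let_def)
qed

lemma ls_decomp:
  assumes "L \<ge> 1" "L + S \<ge> 2" "ls_t L S n \<le> N" "N < ls_t L S (n + 1)"
  shows "\<exists>!(\<eta>, r). \<eta> \<le> L + S - 2 \<and> r < ls_l L S n \<and> N = ls_t L S n + \<eta> * ls_l L S n + r"
proof -
  define l q r where "l = ls_l L S n" and "q = (N - ls_t L S n) div l" and "r = (N - ls_t L S n) mod l"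
  have l: "l > 0" using ls_l_pos[OF assms(1)] by (simp add: l_def)
  have "N - ls_t L S n < (L + S - 1) * l"
    using assms(3,4) ls_t_Suc[OF assms(1), of S n] by (simp add: l_def)
  hence q: "q < L + S - 1" by (simp add: q_def less_mult_imp_div_less)
  have r: "r < l" using l by (simp add: r_def)
  have N: "N = ls_t L S n + q * l + r"
    using assms(3) by (simp add: q_def r_def)
  have uniq: "q' = q \<and> r' = r" if "r' < l" "N = ls_t L S n + q' * l + r'" for q' r'
    using that by (simp add: q_def r_def)
  show ?thesis unfolding l_def[symmetric]
  proof (rule ex1I[of _ "(q, r)"])
    show "case (q, r) of (\<eta>, r) \<Rightarrow> \<eta> \<le> L + S - 2 \<and> r < l \<and> N = ls_t L S n + \<eta> * l + r"
      unfolding prod.case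
    proof (intro conjI)
      show "q \<le> L + S - 2" using q by linarith
    qed (fact r N)+
  next
    fix p
    assume p: "case p of (\<eta>, r) \<Rightarrow> \<eta> \<le> L + S - 2 \<and> r < l \<and> N = ls_t L S n + \<eta> * l + r"
    obtain q' r' where p_eq: "p = (q', r')" by (rule prod.exhaust)
    have "q' = q \<and> r' = r" by (rule uniq) (use p in \<open>simp_all only: p_eq prod.case\<close>)
    thus "p = (q, r)" unfolding p_eq by (simp only:)
  qed
qed

definition half_open_box :: "'a::euclidean_space \<Rightarrow> 'a \<Rightarrow> 'a set" where
  "half_open_box a b = {x. \<forall>i\<in>Basis. a \<bullet> i \<le> x \<bullet> i \<and> x \<bullet> i < b \<bullet> i}"

text \<open>No fractional parts are taken: the notion is meant for sequences in the unit cube.\<close>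

definition uniformly_distributed_mod1 :: "(nat \<Rightarrow> 'a::euclidean_space) \<Rightarrow> bool" where
  "uniformly_distributed_mod1 y \<longleftrightarrow>
    (\<forall>a b. (\<forall>i\<in>Basis. 0 \<le> a \<bullet> i \<and> a \<bullet> i < b \<bullet> i \<and> b \<bullet> i \<le> 1) \<longrightarrow>
      (\<lambda>N. real (card {n. n \<le> N \<and> y n \<in> half_open_box a b}) / real (N + 1))
        \<longlonglongrightarrow> measure lborel (half_open_box a b))"

end

theory Submission
  imports Defs
begin

text \<open>
  Let \<open>\<rho> = S \<beta>\<close>; since \<open>S \<le> L\<close> we have \<open>\<rho> < 1\<close>, and \<open>-\<rho>\<close> is the Galois conjugate of \<open>1 / \<beta>\<close>.
  Hence \<open>\<beta>\<^sup>k l\<^sub>i\<close> and \<open>\<beta>\<^sup>k t\<^sub>i\<close> are within \<open>O(\<rho>\<^sup>i)\<close> of integers, so \<open>N \<beta>\<^sup>k\<close> modulo 1 is determined up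
  to \<open>O(\<rho>\<^sup>n)\<close> by the digits of \<open>N\<close> below level \<open>n\<close>. These digits vanish if \<open>\<xi>\<^sup>N\<close> is
  in \<open>[0, \<beta>\<^sup>n)\<close>, and they are those of \<open>N = 1\<close> if \<open>\<xi>\<^sup>N\<close> is in \<open>[\<beta>, \<beta> + \<beta>\<^sup>n)\<close>. If
  \<open>q \<beta>\<^sub>1\<^bsup>k+1\<^esup> = p \<beta>\<^sub>2\<^bsup>m+1\<^esup>\<close> with integers \<open>p\<close>, \<open>q\<close>, a point of the sequence in
  \<open>[0, \<beta>\<^sub>1\<^bsup>n\<^esup>) \<times> [\<beta>\<^sub>2, \<beta>\<^sub>2 + \<beta>\<^sub>2\<^bsup>n'\<^esup>)\<close> with large \<open>n\<close>, \<open>n'\<close> would therefore force \<open>p \<beta>\<^sub>2\<^bsup>m+1\<^esup>\<close> arbitrarily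
  close to an integer, although \<open>\<beta>\<^sub>2\<^bsup>m+1\<^esup>\<close> is irrational. So this box contains no point.
\<close>

section \<open>Parameters, interval lengths and interval counts\<close>

locale ls_params =
  fixes L S :: nat
  assumes S_pos: "1 \<le> S" and S_le_L: "S \<le> L"
begin

abbreviation "\<beta> \<equiv> ls_beta L S"
abbreviation "t \<equiv> ls_t L S"
abbreviation "l \<equiv> ls_l L S"
abbreviation "\<xi> \<equiv> ls_point L S"

definition \<rho> :: real where "\<rho> = real S * \<beta>"

lemma L_pos: "1 \<le> L" and LS_ge_2: "2 \<le> L + S"
  using S_pos S_le_L by linarith+

lemma beta_pos: "0 < \<beta>"
  by (rule ls_beta_pos[OF L_pos])

lemma beta_eq: "real L * \<beta> + real S * \<beta>\<^sup>2 = 1"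
  by (rule ls_beta_eq[OF L_pos])

lemma beta_less_1: "\<beta> < 1"
  by (rule ls_beta_less_1[OF L_pos LS_ge_2])

lemma beta_power_antimono: "m \<le> n \<Longrightarrow> \<beta> ^ n \<le> \<beta> ^ m"
  using beta_pos beta_less_1 by (intro power_decreasing) auto

lemma beta_power_split: "\<beta> ^ i = real L * \<beta> ^ (i + 1) + real S * \<beta> ^ (i + 2)"
proof -
  have "\<beta> ^ i = \<beta> ^ i * (real L * \<beta> + real S * \<beta>\<^sup>2)"
    by (simp add: beta_eq)
  thus ?thesis by (simp add: algebra_simps power2_eq_square)
qed

lemma rho_pos: "0 < \<rho>"
  using beta_pos S_pos by (simp add: \<rho>_def)

lemma rho_less_1: "\<rho> < 1"
proof -
  have "real S * \<beta> \<le> real L * \<beta>"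
    using S_le_L beta_pos by (intro mult_right_mono) auto
  moreover have "0 < real S * \<beta>\<^sup>2" using beta_pos S_pos by simp
  ultimately show ?thesis using beta_eq unfolding \<rho>_def by linarith
qed

text \<open>Counts long plus short intervals: each of the \<open>l i\<close> long intervals split
  last contributes S short ones. The recursions have order two, hence the induction on
  pairs.\<close>

lemma ls_t_Suc_eq: "t (Suc i) = l (Suc i) + S * l i"
proof -
  have "t (Suc i) = l (Suc i) + S * l i \<and> t (Suc (Suc i)) = l (Suc (Suc i)) + S * l (Suc i)"
  proof (induction i)
    case (Suc i)
    have "t (Suc (Suc (Suc i))) = L * t (Suc (Suc i)) + S * t (Suc i)" by (rule ls_t.simps)
    also have "\<dots> = L * (l (Suc (Suc i)) + S * l (Suc i)) + S * (l (Suc i) + S * l i)"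
      using Suc.IH by (simp only:)
    also have "\<dots> = l (Suc (Suc (Suc i))) + S * l (Suc (Suc i))"
      by (simp add: algebra_simps)
    finally show ?case using Suc.IH by blast
  qed (simp add: algebra_simps)
  thus ?thesis by blast
qed

lemma ls_l_le_t: "l i \<le> t i"
  by (cases i) (simp_all add: ls_t_Suc_eq)

text \<open>Separates the new indices: those below \<open>l (Suc i)\<close> have \<eta> + 1 < L and
  start long intervals, the others start short ones.\<close>

lemma ls_l_Suc_add_l: "l (Suc i) + l i = t i + L * l i"
proof (cases i)
  case (Suc j)
  thus ?thesis using ls_t_Suc_eq[of j] by simp
qed simp

section \<open>Position of the points in the successive partitions\<close>

text \<open>The length of the interval with left endpoint \<open>\<xi>\<^sup>N\<close>, \<open>N < t\<^sub>i\<close>, in the \<open>i\<close>-th partition.\<close>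

definition ival_len :: "nat \<Rightarrow> nat \<Rightarrow> real" where
  "ival_len i N = (if N < l i then \<beta> ^ i else \<beta> ^ (i + 1))"

lemma ival_len_pos: "0 < ival_len i N"
  using beta_pos by (simp add: ival_len_def)

lemma ival_len_Suc_le:
  assumes "N < t i"
  shows "ival_len (Suc i) N \<le> ival_len i N"
  unfolding ival_len_def
  using assms beta_power_antimono[of i "Suc i"] beta_power_antimono[of "Suc i" "Suc (Suc i)"]
    beta_power_antimono[of i "Suc (Suc i)"] by auto

text \<open>A new point arises when the long interval of its parent \<open>r\<close>, of length
  \<beta>^i, is split: it lies beyond the first piece and its own interval stays inside the parent
  interval.\<close>

lemma ls_point_step:
  assumes "t i \<le> N" "N < t (Suc i)"
  obtains \<eta> r where "\<eta> \<le> L + S - 2" "r < l i" "N = t i + \<eta> * l i + r"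
    "\<xi> r + \<beta> ^ (i + 1) \<le> \<xi> N" "\<xi> N + ival_len (Suc i) N \<le> \<xi> r + \<beta> ^ i"
proof -
  obtain \<eta> r where \<eta>: "\<eta> \<le> L + S - 2" and r: "r < l i" and N: "N = t i + \<eta> * l i + r"
    using ls_decomp[OF L_pos LS_ge_2, of i N] assms by auto
  have eq: "\<xi> N = \<xi> r + \<beta> ^ (i + 1) * min (real L) (real \<eta> + 1)
      + \<beta> ^ (i + 2) * max (real \<eta> + 1 - real L) 0"
    using ls_point_rec[OF L_pos LS_ge_2 _ _ N r] assms by simp
  have p: "0 < \<beta> ^ (i + 1)" "0 < \<beta> ^ (i + 2)" using beta_pos by auto
  have "\<beta> ^ (i + 1) * 1 \<le> \<beta> ^ (i + 1) * min (real L) (real \<eta> + 1)"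
    using p L_pos by (intro mult_left_mono) auto
  moreover have "0 \<le> \<beta> ^ (i + 2) * max (real \<eta> + 1 - real L) 0" using p by simp
  ultimately have lower: "\<xi> r + \<beta> ^ (i + 1) \<le> \<xi> N" using eq by simp
  have split: "\<beta> ^ i = \<beta> ^ (i + 1) * real L + \<beta> ^ (i + 2) * real S"
    using beta_power_split[of i] by (simp only: mult.commute)
  have upper: "\<xi> N + ival_len (Suc i) N \<le> \<xi> r + \<beta> ^ i"
  \<comment> \<open>Pieces are numbered from 0 and the parent keeps piece 0, so digit \<eta> means
    piece \<eta> + 1; the pieces below L are long.\<close>
  proof (cases "\<eta> + 1 < L")
    case True
    have "(\<eta> + 2) * l i \<le> L * l i" using True by (intro mult_right_mono) auto
    hence "N < l (Suc i)" using N r ls_l_Suc_add_l[of i] by (simp add: algebra_simps)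
    hence "ival_len (Suc i) N = \<beta> ^ (i + 1)" by (simp add: ival_len_def)
    moreover have "\<beta> ^ (i + 1) * (real \<eta> + 2) \<le> \<beta> ^ (i + 1) * real L"
      using True p by (intro mult_left_mono) auto
    moreover have "0 \<le> \<beta> ^ (i + 2) * real S" using p by simp
    moreover have "\<xi> N = \<xi> r + \<beta> ^ (i + 1) * (real \<eta> + 2) - \<beta> ^ (i + 1)"
      using eq True by (simp add: distrib_left)
    ultimately show ?thesis using split by argo
  next
    case False
    have "L * l i \<le> (\<eta> + 1) * l i" using False by (intro mult_right_mono) auto
    hence "\<not> N < l (Suc i)" using N ls_l_Suc_add_l[of i] by (simp add: algebra_simps)
    hence "ival_len (Suc i) N = \<beta> ^ (i + 2)" by (simp add: ival_len_def)
    moreover have "\<beta> ^ (i + 2) * (real \<eta> + 2 - real L) \<le> \<beta> ^ (i + 2) * real S"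
      using \<eta> LS_ge_2 p by (intro mult_left_mono) auto
    moreover have "\<xi> N = \<xi> r + \<beta> ^ (i + 1) * real L
        + (\<beta> ^ (i + 2) * (real \<eta> + 2 - real L) - \<beta> ^ (i + 2))"
      using eq False by (simp add: distrib_left right_diff_distrib)
    ultimately show ?thesis using split by argo
  qed
  from that[OF \<eta> r N lower upper] show thesis .
qed

text \<open>The interval at 0 stays long, so every other point keeps its distance from 0. A new
  point lies \<beta>^(i+1) beyond a nonnegative parent, so both claims share one induction.\<close>

lemma ls_point_pos: "0 < N \<Longrightarrow> N < t i \<Longrightarrow> \<beta> ^ i \<le> \<xi> N" and ls_point_nonneg: "0 \<le> \<xi> N"
proof -
  have main: "N < t i \<longrightarrow> 0 \<le> \<xi> N \<and> (0 < N \<longrightarrow> \<beta> ^ i \<le> \<xi> N)" for i N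
  proof (induction i arbitrary: N)
    case 0
    show ?case by (auto simp: ls_point_0)
  next
    case (Suc i)
    show ?case
    proof (cases "N < t i")
      case True
      thus ?thesis using Suc.IH[of N] beta_power_antimono[of i "Suc i"] by auto
    next
      case False
      show ?thesis
      proof
        assume "N < t (Suc i)"
        then obtain \<eta> r where "r < l i" "\<xi> r + \<beta> ^ (i + 1) \<le> \<xi> N"
          using False by (elim ls_point_step[rotated]) auto
        moreover have "0 < \<beta> ^ (i + 1)" using beta_pos by simp
        ultimately show "0 \<le> \<xi> N \<and> (0 < N \<longrightarrow> \<beta> ^ Suc i \<le> \<xi> N)"
          using Suc.IH[of r] ls_l_le_t[of i] by auto
      qed
    qed
  qed
  thus "0 < N \<Longrightarrow> N < t i \<Longrightarrow> \<beta> ^ i \<le> \<xi> N" by blast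
  have "N < t (Suc N)"
    using strict_mono_imp_increasing[OF ls_t_strict_mono[OF L_pos LS_ge_2], of "Suc N"] by simp
  thus "0 \<le> \<xi> N" using main by blast
qed

lemma ls_point_below_t_1:
  assumes "0 < N" "N < t 1"
  shows "\<beta> \<le> \<xi> N" "N = 1 \<or> 2 * \<beta> \<le> \<xi> N"
proof -
  have eq: "\<xi> N = \<beta> * min (real L) (real N) + \<beta>\<^sup>2 * max (real N - real L) 0"
    using ls_point_rec[OF L_pos LS_ge_2, of 0 N "N - 1" 0] assms
    by (simp add: ls_point_0 of_nat_diff power2_eq_square)
  have "0 \<le> \<beta>\<^sup>2 * max (real N - real L) 0" by simp
  moreover have "\<beta> * 1 \<le> \<beta> * min (real L) (real N)"
    using L_pos assms beta_pos by (intro mult_left_mono) auto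
  ultimately show "\<beta> \<le> \<xi> N" using eq by argo
  have "\<beta> * 2 \<le> \<beta> * min (real L) (real N)" if "N \<noteq> 1"
  proof -
    \<comment> \<open>L = 1 would force S = 1, hence \<open>t 1 = 2\<close> and N = 1.\<close>
    have "2 \<le> L" using that assms S_le_L S_pos by auto
    thus ?thesis using that assms beta_pos by (intro mult_left_mono) auto
  qed
  with \<open>0 \<le> \<beta>\<^sup>2 * max (real N - real L) 0\<close> show "N = 1 \<or> 2 * \<beta> \<le> \<xi> N"
    using eq by argo
qed

text \<open>No interval of the \<open>i\<close>-th partition contains \<open>\<beta>\<close> in its interior.\<close>

lemma ls_point_ge_beta_or:
  assumes "1 \<le> i" "N < t i"
  shows "\<beta> \<le> \<xi> N \<or> \<xi> N + ival_len i N \<le> \<beta>"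
  using assms
proof (induction i arbitrary: N rule: dec_induct)
  case base
  thus ?case
    using ls_point_below_t_1[of N] L_pos by (cases "N = 0") (auto simp: ls_point_0 ival_len_def)
next
  case (step i)
  show ?case
  proof (cases "N < t i")
    case True
    thus ?thesis using step.IH[OF True] ival_len_Suc_le[OF True] by auto
  next
    case False
    then obtain \<eta> r where r: "r < l i" "\<xi> r + \<beta> ^ (i + 1) \<le> \<xi> N"
      "\<xi> N + ival_len (Suc i) N \<le> \<xi> r + \<beta> ^ i"
      using step.prems by (elim ls_point_step[rotated]) auto
    have "0 < \<beta> ^ (i + 1)" using beta_pos by simp
    moreover have "\<beta> \<le> \<xi> r \<or> \<xi> r + \<beta> ^ i \<le> \<beta>"
      using step.IH[of r] r(1) ls_l_le_t[of i] by (auto simp: ival_len_def)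
    ultimately show ?thesis using r by linarith
  qed
qed

text \<open>Otherwise the parent interval would end at or before \<beta>, leaving no room for a
  child interval of positive length.\<close>

lemma ls_point_ge_beta_imp:
  assumes "1 \<le> i" "r < l i" "\<xi> N + ival_len (Suc i) N \<le> \<xi> r + \<beta> ^ i" "\<beta> \<le> \<xi> N"
  shows "\<beta> \<le> \<xi> r"
  using ls_point_ge_beta_or[OF assms(1), of r] assms(2-) ls_l_le_t[of i]
    ival_len_pos[of "Suc i" N] by (auto simp: ival_len_def[of i])

text \<open>While the level i climbs to the fixed n, each new point lies at least \<beta>^n beyond a
  parent that is itself at or after \<beta>, hence outside the window.\<close>

lemma ls_point_near_beta_eq_1:
  assumes "1 \<le> i" "i \<le> n" "N < t i" "\<beta> \<le> \<xi> N" "\<xi> N < \<beta> + \<beta> ^ n"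
  shows "N = 1"
  using assms
proof (induction i arbitrary: N rule: dec_induct)
  case base
  have "N \<noteq> 0" using base beta_pos by (metis ls_point_0 not_le)
  moreover have "\<beta> ^ n \<le> \<beta>" using beta_power_antimono[of 1 n] base by simp
  ultimately show ?case using ls_point_below_t_1(2)[of N] base by auto
next
  case (step i)
  show ?case
  proof (cases "N < t i")
    case True
    thus ?thesis using step by auto
  next
    case False
    then obtain \<eta> r where r: "r < l i" "\<xi> r + \<beta> ^ (i + 1) \<le> \<xi> N"
      "\<xi> N + ival_len (Suc i) N \<le> \<xi> r + \<beta> ^ i"
      using step.prems by (elim ls_point_step[rotated]) auto
    have "\<beta> \<le> \<xi> r" by (rule ls_point_ge_beta_imp[OF step.hyps(1) r(1,3) step.prems(3)])
    moreover have "\<beta> ^ n \<le> \<beta> ^ (i + 1)" using step.prems by (intro beta_power_antimono) auto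
    ultimately have False using r step.prems by linarith
    thus ?thesis ..
  qed
qed

section \<open>Multiples of powers of \<beta> close to integers\<close>

text \<open>The difference of the two sequences obeys the recursion of \<open>l\<close>, with
  characteristic roots 1/\<beta> and -\<rho>; the growing component cancels, leaving a multiple of
  (-\<rho>)^i.\<close>

lemma beta_mult_ls_l: "\<beta> * real (l (Suc i)) = real (l i) + \<beta> * (- \<rho>) ^ Suc i"
proof -
  have "\<beta> * real (l (Suc i)) = real (l i) + \<beta> * (- \<rho>) ^ Suc i
    \<and> \<beta> * real (l (Suc (Suc i))) = real (l (Suc i)) + \<beta> * (- \<rho>) ^ Suc (Suc i)"
  proof (induction i)
    case 0
    have a: "\<beta> * real L = 1 - \<beta> * \<rho>"
      using beta_eq by (simp add: \<rho>_def power2_eq_square algebra_simps)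
    have "\<beta> * real (l (Suc (Suc 0))) = (\<beta> * real L) * real L + \<rho>"
      by (simp add: algebra_simps \<rho>_def)
    also have "\<dots> = (1 - \<beta> * \<rho>) * real L + \<rho>" by (simp only: a)
    also have "\<dots> = real L - (\<beta> * real L) * \<rho> + \<rho>" by (simp only: algebra_simps)
    also have "\<dots> = real L + \<beta> * \<rho>\<^sup>2"
      by (simp only: a) (simp add: power2_eq_square algebra_simps)
    finally show ?case using a by (simp add: power2_eq_square)
  next
    case (Suc i)
    have "\<rho> * \<rho> = real S * (real S * \<beta>\<^sup>2)"
      by (simp add: \<rho>_def power2_eq_square)
    also have "\<dots> = real S * (1 - real L * \<beta>)" using beta_eq by (simp add: eq_diff_eq)
    finally have "\<rho> * \<rho> = real S - real L * \<rho>" by (simp add: \<rho>_def algebra_simps)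
    hence "\<rho> * \<rho> * (- \<rho>) ^ j = (real S - real L * \<rho>) * (- \<rho>) ^ j" for j by simp
    hence char: "(- \<rho>) ^ Suc (Suc j) = real L * (- \<rho>) ^ Suc j + real S * (- \<rho>) ^ j" for j
      by (simp add: algebra_simps)
    have "\<beta> * real (l (Suc (Suc (Suc i)))) =
        real L * (\<beta> * real (l (Suc (Suc i)))) + real S * (\<beta> * real (l (Suc i)))"
      by (simp add: algebra_simps)
    also have "\<dots> = real (l (Suc (Suc i)))
        + \<beta> * (real L * (- \<rho>) ^ Suc (Suc i) + real S * (- \<rho>) ^ Suc i)"
      using Suc.IH by (simp only: ls_l.simps of_nat_add of_nat_mult) (simp only: algebra_simps)
    finally show ?case using Suc.IH char[of "Suc i"] by simp
  qed
  thus ?thesis by blast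
qed

text \<open>Each factor \<beta> lowers the index of \<open>l\<close> by one at the cost of an error
  of order \<rho>^i, so k factors require i >= k.\<close>

lemma ls_l_mult_beta_power_near_int:
  "\<exists>D\<ge>0. \<forall>i\<ge>k. \<exists>z::int. \<bar>real (l i) * \<beta> ^ k - of_int z\<bar> \<le> D * \<rho> ^ i"
proof (induction k)
  case 0
  have "\<bar>real (l i) * \<beta> ^ 0 - of_int (int (l i))\<bar> \<le> 0 * \<rho> ^ i" for i by simp
  thus ?case by blast
next
  case (Suc k)
  then obtain D where D: "0 \<le> D"
    "\<And>i. k \<le> i \<Longrightarrow> \<exists>z::int. \<bar>real (l i) * \<beta> ^ k - of_int z\<bar> \<le> D * \<rho> ^ i" by blast
  \<comment> \<open>D / \<rho> expresses the inherited error at level i - 1 through \<rho>^i; the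
    summand 1 covers the new error.\<close>
  have "\<exists>z::int. \<bar>real (l i) * \<beta> ^ Suc k - of_int z\<bar> \<le> (D / \<rho> + 1) * \<rho> ^ i" if i: "Suc k \<le> i" for i
  proof -
    obtain j where j: "i = Suc j" "k \<le> j" using i by (cases i) auto
    obtain z :: int where z: "\<bar>real (l j) * \<beta> ^ k - of_int z\<bar> \<le> D * \<rho> ^ j" using D(2) j(2) by blast
    have "real (l i) * \<beta> ^ Suc k = real (l j) * \<beta> ^ k + \<beta> ^ Suc k * (- \<rho>) ^ i"
      using arg_cong[OF beta_mult_ls_l[of j], of "\<lambda>u. u * \<beta> ^ k"] unfolding j(1)
      by (simp only: power_Suc distrib_right distrib_left mult_ac)
    moreover have "\<bar>\<beta> ^ Suc k * (- \<rho>) ^ i\<bar> \<le> 1 * \<rho> ^ i"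
      using beta_power_antimono[of 0 "Suc k"] beta_pos rho_pos
      unfolding abs_mult power_abs by (intro mult_mono) auto
    moreover have "D * \<rho> ^ j = D / \<rho> * \<rho> ^ i" using rho_pos j by simp
    ultimately have "\<bar>real (l i) * \<beta> ^ Suc k - of_int z\<bar> \<le> D / \<rho> * \<rho> ^ i + 1 * \<rho> ^ i"
      using z by linarith
    thus ?thesis unfolding distrib_right by blast
  qed
  moreover have "0 \<le> D / \<rho> + 1" using D(1) rho_pos by simp
  ultimately show ?case by blast
qed

text \<open>The integer is (\<eta> + 1) \<open>l i\<close> + S \<open>l (i - 1)\<close>, with
  bounded coefficients; the index i - 1 explains i > k.\<close>

lemma digit_mult_beta_power_near_int:
  "\<exists>C\<ge>0. \<forall>i>k. \<forall>\<eta>\<le>L + S - 2. \<exists>z::int.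
      \<bar>real (t i + \<eta> * l i) * \<beta> ^ k - of_int z\<bar> \<le> C * \<rho> ^ i"
proof -
  obtain D where D: "0 \<le> D"
    "\<And>i. k \<le> i \<Longrightarrow> \<exists>z::int. \<bar>real (l i) * \<beta> ^ k - of_int z\<bar> \<le> D * \<rho> ^ i"
    using ls_l_mult_beta_power_near_int by blast
  define C where "C = real (L + S) * D + real S * (D / \<rho>)"
  have "\<exists>z::int. \<bar>real (t i + \<eta> * l i) * \<beta> ^ k - of_int z\<bar> \<le> C * \<rho> ^ i"
    if i: "k < i" and \<eta>: "\<eta> \<le> L + S - 2" for i \<eta>
  proof -
    obtain j where j: "i = Suc j" "k \<le> j" using i by (cases i) auto
    obtain z z' :: int where z: "\<bar>real (l i) * \<beta> ^ k - of_int z\<bar> \<le> D * \<rho> ^ i"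
      and z': "\<bar>real (l j) * \<beta> ^ k - of_int z'\<bar> \<le> D * \<rho> ^ j"
      using D(2)[of i] D(2)[of j] j i by auto
    have "real (t i + \<eta> * l i) * \<beta> ^ k - of_int (int (\<eta> + 1) * z + int S * z')
       = real (\<eta> + 1) * (real (l i) * \<beta> ^ k - of_int z) + real S * (real (l j) * \<beta> ^ k - of_int z')"
      unfolding j(1) ls_t_Suc_eq by (simp only: of_nat_add of_nat_mult of_int_add of_int_mult
        of_int_of_nat_eq of_nat_1) (simp only: algebra_simps)
    also have "\<bar>\<dots>\<bar> \<le> real (\<eta> + 1) * \<bar>real (l i) * \<beta> ^ k - of_int z\<bar>
        + real S * \<bar>real (l j) * \<beta> ^ k - of_int z'\<bar>"
      by (rule order_trans[OF abs_triangle_ineq]) (simp add: abs_mult)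
    also have "\<dots> \<le> real (L + S) * (D * \<rho> ^ i) + real S * (D * \<rho> ^ j)"
      using z z' \<eta> LS_ge_2 by (intro add_mono mult_mono) auto
    also have "\<dots> = C * \<rho> ^ i" using rho_pos j by (simp add: C_def algebra_simps)
    finally show ?thesis by blast
  qed
  moreover have "0 \<le> C" using D(1) rho_pos by (simp add: C_def)
  ultimately show ?thesis by blast
qed

text \<open>
  The hypotheses say that the interval \<open>[x, x + \<beta>\<^sup>n)\<close> consists of descendants of
  \<open>s\<close>; the errors of the levels \<open>\<ge> n\<close> are summed as a geometric series.
\<close>

lemma mult_beta_power_near_int:
  assumes C: "\<And>i \<eta>. k < i \<Longrightarrow> \<eta> \<le> L + S - 2 \<Longrightarrow>
      \<exists>z::int. \<bar>real (t i + \<eta> * l i) * \<beta> ^ k - of_int z\<bar> \<le> C * \<rho> ^ i"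
    and C0: "0 \<le> C" and "k < n"
    and init: "\<And>N. N < t n \<Longrightarrow> x \<le> \<xi> N \<Longrightarrow> \<xi> N < x + \<beta> ^ n \<Longrightarrow> N = s"
    and parent: "\<And>i r N. n \<le> i \<Longrightarrow> r < l i \<Longrightarrow> \<xi> N + ival_len (Suc i) N \<le> \<xi> r + \<beta> ^ i \<Longrightarrow>
      x \<le> \<xi> N \<Longrightarrow> x \<le> \<xi> r"
    and "n \<le> i" "N < t i" "x \<le> \<xi> N" "\<xi> N < x + \<beta> ^ n"
  shows "\<exists>z::int. \<bar>real N * \<beta> ^ k - real s * \<beta> ^ k - of_int z\<bar> \<le> C / (1 - \<rho>) * (\<rho> ^ n - \<rho> ^ i)"
  using assms(6-)
proof (induction i arbitrary: N rule: dec_induct)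
  case base
  have "N = s" using init base by blast
  thus ?case by (intro exI[of _ 0]) simp
next
  case (step i)
  define K where "K = C / (1 - \<rho>)"
  have K: "K * (1 - \<rho>) = C" "0 \<le> K" using rho_less_1 C0 by (simp_all add: K_def)
  \<comment> \<open>K (\<rho>^n - \<rho>^i) is the closed form of C (\<rho>^n + ... + \<rho>^(i-1));
    one more level adds the next term.\<close>
  have K_step: "K * (\<rho> ^ n - \<rho> ^ i) + C * \<rho> ^ i = K * (\<rho> ^ n - \<rho> ^ Suc i)"
    by (simp add: K(1)[symmetric] algebra_simps)
  have pos: "0 \<le> C * \<rho> ^ i" using C0 rho_pos by simp
  show ?case
  proof (cases "N < t i")
    case True
    then obtain z :: int where
      "\<bar>real N * \<beta> ^ k - real s * \<beta> ^ k - of_int z\<bar> \<le> K * (\<rho> ^ n - \<rho> ^ i)"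
      using step unfolding K_def by blast
    with K_step pos have
      "\<bar>real N * \<beta> ^ k - real s * \<beta> ^ k - of_int z\<bar> \<le> K * (\<rho> ^ n - \<rho> ^ Suc i)" by linarith
    thus ?thesis unfolding K_def by blast
  next
    case False
    then obtain \<eta> r where r: "\<eta> \<le> L + S - 2" "r < l i" "N = t i + \<eta> * l i + r"
      "\<xi> r + \<beta> ^ (i + 1) \<le> \<xi> N" "\<xi> N + ival_len (Suc i) N \<le> \<xi> r + \<beta> ^ i"
      using step.prems by (elim ls_point_step[rotated]) auto
    have "x \<le> \<xi> r" by (rule parent[OF step.hyps(1) r(2,5) step.prems(2)])
    moreover have "0 < \<beta> ^ (i + 1)" using beta_pos by simp
    hence "\<xi> r < x + \<beta> ^ n" using r(4) step.prems by linarith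
    moreover have "r < t i" using r(2) ls_l_le_t[of i] by simp
    ultimately obtain z :: int where
      z: "\<bar>real r * \<beta> ^ k - real s * \<beta> ^ k - of_int z\<bar> \<le> K * (\<rho> ^ n - \<rho> ^ i)"
      using step.IH unfolding K_def by blast
    obtain w :: int where w: "\<bar>real (t i + \<eta> * l i) * \<beta> ^ k - of_int w\<bar> \<le> C * \<rho> ^ i"
      using C[OF _ r(1), of i] step.hyps \<open>k < n\<close> by auto
    have "real N * \<beta> ^ k = real (t i + \<eta> * l i) * \<beta> ^ k + real r * \<beta> ^ k"
      unfolding r(3) of_nat_add[of _ r] distrib_right ..
    hence "\<bar>real N * \<beta> ^ k - real s * \<beta> ^ k - of_int (z + w)\<bar> \<le> K * (\<rho> ^ n - \<rho> ^ Suc i)"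
      using z w K_step by simp
    thus ?thesis unfolding K_def by blast
  qed
qed

text \<open>The geometric bound stays below C/(1 - \<rho>) \<rho>^n at every level, so one large n
  serves all N.\<close>

lemma mult_beta_power_near_int_uniform:
  assumes init: "\<And>n N. 1 \<le> n \<Longrightarrow> N < t n \<Longrightarrow> x \<le> \<xi> N \<Longrightarrow> \<xi> N < x + \<beta> ^ n \<Longrightarrow> N = s"
    and parent: "\<And>i r N. 1 \<le> i \<Longrightarrow> r < l i \<Longrightarrow>
      \<xi> N + ival_len (Suc i) N \<le> \<xi> r + \<beta> ^ i \<Longrightarrow> x \<le> \<xi> N \<Longrightarrow> x \<le> \<xi> r"
    and "0 < \<epsilon>"
  shows "\<exists>n. \<forall>N. x \<le> \<xi> N \<longrightarrow> \<xi> N < x + \<beta> ^ n \<longrightarrow>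
      (\<exists>z::int. \<bar>real N * \<beta> ^ k - real s * \<beta> ^ k - of_int z\<bar> < \<epsilon>)"
proof -
  obtain C where C0: "0 \<le> C" and C: "\<And>i \<eta>. k < i \<Longrightarrow> \<eta> \<le> L + S - 2 \<Longrightarrow>
      \<exists>z::int. \<bar>real (t i + \<eta> * l i) * \<beta> ^ k - of_int z\<bar> \<le> C * \<rho> ^ i"
    using digit_mult_beta_power_near_int[of k] by (elim exE conjE) blast
  define K where "K = C / (1 - \<rho>)"
  have K: "0 \<le> K" using C0 rho_less_1 by (simp add: K_def)
  have "(\<lambda>n. K * \<rho> ^ n) \<longlonglongrightarrow> K * 0"
    using rho_pos rho_less_1 by (intro tendsto_intros LIMSEQ_power_zero) auto
  hence "\<forall>\<^sub>F n in sequentially. K * \<rho> ^ n < \<epsilon>"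
    using \<open>0 < \<epsilon>\<close> by (intro order_tendstoD(2)) auto
  hence "\<forall>\<^sub>F n in sequentially. K * \<rho> ^ n < \<epsilon> \<and> k < n"
    using eventually_gt_at_top[of k] by (rule eventually_conj)
  then obtain n where n: "K * \<rho> ^ n < \<epsilon>" "k < n"
    using eventually_happens'[OF sequentially_bot] by blast
  have "\<exists>z::int. \<bar>real N * \<beta> ^ k - real s * \<beta> ^ k - of_int z\<bar> < \<epsilon>"
    if N: "x \<le> \<xi> N" "\<xi> N < x + \<beta> ^ n" for N
  proof -
    define i where "i = n + Suc N"
    have "N < t i"
      using strict_mono_imp_increasing[OF ls_t_strict_mono[OF L_pos LS_ge_2], of i]
      by (simp add: i_def)
    have "\<exists>z::int. \<bar>real N * \<beta> ^ k - real s * \<beta> ^ k - of_int z\<bar> \<le> K * (\<rho> ^ n - \<rho> ^ i)"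
      unfolding K_def
    proof (rule mult_beta_power_near_int[OF C C0 n(2) _ _ _ \<open>N < t i\<close> N])
      show "M = s" if "M < t n" "x \<le> \<xi> M" "\<xi> M < x + \<beta> ^ n" for M
        by (rule init[OF _ that]) (use n(2) in simp)
      show "x \<le> \<xi> r" if "n \<le> j" "r < l j" "\<xi> M + ival_len (Suc j) M \<le> \<xi> r + \<beta> ^ j"
        "x \<le> \<xi> M" for j r M
        by (rule parent[OF _ that(2-4)]) (use n(2) that(1) in simp)
    qed (auto simp: i_def)
    then obtain z :: int where
      z: "\<bar>real N * \<beta> ^ k - real s * \<beta> ^ k - of_int z\<bar> \<le> K * (\<rho> ^ n - \<rho> ^ i)" by blast
    have "K * (\<rho> ^ n - \<rho> ^ i) \<le> K * \<rho> ^ n"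
      using K rho_pos by (intro mult_left_mono) auto
    with z n have "\<bar>real N * \<beta> ^ k - real s * \<beta> ^ k - of_int z\<bar> < \<epsilon>" by linarith
    thus ?thesis by blast
  qed
  thus ?thesis by blast
qed

text \<open>Case x = 0, s = 0: the parent condition is just nonnegativity.\<close>

lemma near_0:
  assumes "0 < \<epsilon>"
  shows "\<exists>n. \<forall>N. \<xi> N < \<beta> ^ n \<longrightarrow> (\<exists>z::int. \<bar>real N * \<beta> ^ k - of_int z\<bar> < \<epsilon>)"
proof -
  have "N = 0" if "N < t n" "\<xi> N < 0 + \<beta> ^ n" for n N
    using ls_point_pos[of N n] that by force
  thus ?thesis
    using mult_beta_power_near_int_uniform[of 0 0 \<epsilon> k] ls_point_nonneg assms by simp
qed

text \<open>Case x = \<beta>, s = 1: the extra term \<beta>^k comes from index 1, whose point is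
  \<beta>.\<close>

lemma near_beta:
  assumes "0 < \<epsilon>"
  shows "\<exists>n. \<forall>N. \<beta> \<le> \<xi> N \<longrightarrow> \<xi> N < \<beta> + \<beta> ^ n \<longrightarrow>
      (\<exists>z::int. \<bar>real N * \<beta> ^ k - \<beta> ^ k - of_int z\<bar> < \<epsilon>)"
proof -
  have "\<exists>n. \<forall>N. \<beta> \<le> \<xi> N \<longrightarrow> \<xi> N < \<beta> + \<beta> ^ n \<longrightarrow>
      (\<exists>z::int. \<bar>real N * \<beta> ^ k - real 1 * \<beta> ^ k - of_int z\<bar> < \<epsilon>)"
  proof (rule mult_beta_power_near_int_uniform)
    show "N = 1" if "1 \<le> n" "N < t n" "\<beta> \<le> \<xi> N" "\<xi> N < \<beta> + \<beta> ^ n" for n N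
      by (rule ls_point_near_beta_eq_1[OF that(1) order.refl that(2-4)])
  qed (fact ls_point_ge_beta_imp assms)+
  thus ?thesis by simp
qed

section \<open>Irrationality of the powers of \<beta>\<close>

text \<open>In lowest terms p/q the quadratic equation gives p | q^2, so p = 1 and S = q (q - L).
  Then q > L and S >= q > L, against S <= L.\<close>

lemma beta_irrational: "\<beta> \<notin> \<rat>"
proof
  assume "\<beta> \<in> \<rat>"
  then obtain p q :: int where pq: "0 < q" "coprime p q" "\<beta> = of_int p / of_int q"
    by (rule Rats_cases')
  have "of_int (int L * p * q + int S * p\<^sup>2) = (of_int (q\<^sup>2) :: real)"
    using beta_eq pq(1) unfolding pq(3) by (simp add: field_simps power2_eq_square)
  hence eq: "int L * p * q + int S * p\<^sup>2 = q\<^sup>2" by (simp only: of_int_eq_iff)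
  have "0 < p" using beta_pos pq by (simp add: zero_less_divide_iff)
  have "p dvd q\<^sup>2" unfolding eq[symmetric] by (simp add: power2_eq_square mult.assoc)
  hence "p dvd 1"
    using pq(2) by (metis coprime_common_divisor coprime_power_right_iff dvd_refl zero_less_numeral)
  hence "p = 1" using \<open>0 < p\<close> by simp
  with eq have eq': "int S = q * (q - int L)" by (simp add: power2_eq_square algebra_simps)
  have "0 < q * (q - int L)" using eq' S_pos by simp
  hence "q > int L" using pq(1) by (simp add: zero_less_mult_iff)
  hence "q * 1 \<le> q * (q - int L)" using pq(1) by (intro mult_left_mono) auto
  with eq' \<open>q > int L\<close> S_le_L show False by linarith
qed

text \<open>The inverse \<alpha> satisfies \<alpha>^2 = L \<alpha> + S, so its positive powers are a
  \<alpha> + b with a > 0; a rational power would make \<alpha> rational.\<close>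

lemma beta_power_irrational: "\<beta> ^ Suc m \<notin> \<rat>"
proof
  assume rat: "\<beta> ^ Suc m \<in> \<rat>"
  define \<alpha> where "\<alpha> = 1 / \<beta>"
  have \<alpha>: "\<alpha>\<^sup>2 = real L * \<alpha> + real S"
    using beta_eq beta_pos by (simp add: \<alpha>_def field_simps power2_eq_square)
  have "\<exists>a b :: nat. 0 < a \<and> \<alpha> ^ Suc m = real a * \<alpha> + real b"
  proof (induction m)
    case 0
    show ?case by (rule exI[of _ 1], rule exI[of _ 0]) simp
  next
    case (Suc m)
    then obtain a b :: nat where ab: "0 < a" "\<alpha> ^ Suc m = real a * \<alpha> + real b" by blast
    have "\<alpha> ^ Suc (Suc m) = real a * \<alpha>\<^sup>2 + real b * \<alpha>"
      unfolding power_Suc[of _ "Suc m"] ab(2) by (simp add: power2_eq_square algebra_simps)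
    also have "\<dots> = real (a * L + b) * \<alpha> + real (a * S)"
      unfolding \<alpha> by (simp add: algebra_simps)
    finally have "\<alpha> ^ Suc (Suc m) = real (a * L + b) * \<alpha> + real (a * S)" .
    moreover have "0 < a * L + b" using ab L_pos by simp
    ultimately show ?case by blast
  qed
  then obtain a b :: nat where ab: "0 < a" "\<alpha> ^ Suc m = real a * \<alpha> + real b" by blast
  have "\<alpha> ^ Suc m = 1 / \<beta> ^ Suc m" unfolding \<alpha>_def by (simp add: power_one_over)
  hence "\<alpha> ^ Suc m \<in> \<rat>" using rat by (metis Rats_1 Rats_divide)
  hence "(\<alpha> ^ Suc m - real b) / real a \<in> \<rat>" by (intro Rats_divide Rats_diff) auto
  also have "(\<alpha> ^ Suc m - real b) / real a = \<alpha>" using ab by simp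
  finally have "1 / \<alpha> \<in> \<rat>" by (intro Rats_divide) auto
  thus False using beta_irrational by (simp add: \<alpha>_def)
qed

end

lemma irrational_dist_Ints:
  fixes x :: real
  assumes "x \<notin> \<rat>"
  shows "\<exists>d>0. \<forall>z::int. d \<le> \<bar>x - of_int z\<bar>"
proof -
  have "x \<notin> \<int>" using assms Ints_subset_Rats by blast
  have "0 < frac x" "frac x < 1" using \<open>x \<notin> \<int>\<close> frac_lt_1 by (auto simp: frac_gt_0_iff)
  moreover have "min (frac x) (1 - frac x) \<le> \<bar>x - of_int z\<bar>" for z :: int
  proof (cases "z \<le> \<lfloor>x\<rfloor>")
    case True
    hence "of_int z \<le> (of_int \<lfloor>x\<rfloor> :: real)" by (simp only: of_int_le_iff)
    thus ?thesis by (simp add: frac_def)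
  next
    case False
    hence "of_int (\<lfloor>x\<rfloor> + 1) \<le> (of_int z :: real)" by (simp only: of_int_le_iff)
    thus ?thesis by (simp add: frac_def)
  qed
  ultimately show ?thesis by (intro exI[of _ "min (frac x) (1 - frac x)"]) auto
qed

section \<open>Consequences of an empty box\<close>

lemma half_open_box_prod:
  "half_open_box (a, c) (b, d) = {a..<b} \<times> {c..<d :: real}" for a b :: real
  by (auto simp: half_open_box_def Basis_prod_def)

lemma not_uniformly_distributed_mod1_if_empty_box:
  fixes y :: "nat \<Rightarrow> 'a::euclidean_space"
  assumes ab: "\<And>i. i \<in> Basis \<Longrightarrow> 0 \<le> a \<bullet> i \<and> a \<bullet> i < b \<bullet> i \<and> b \<bullet> i \<le> 1"
    and empty: "\<And>n. y n \<notin> half_open_box a b"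
  shows "\<not> uniformly_distributed_mod1 y"
proof
  assume "uniformly_distributed_mod1 y"
  hence "(\<lambda>N. real (card {n. n \<le> N \<and> y n \<in> half_open_box a b}) / real (N + 1))
      \<longlonglongrightarrow> measure lborel (half_open_box a b)"
    using ab unfolding uniformly_distributed_mod1_def by blast
  hence "(\<lambda>N. 0) \<longlonglongrightarrow> measure lborel (half_open_box a b)" using empty by simp
  hence zero: "measure lborel (half_open_box a b) = 0"
    by (simp add: LIMSEQ_const_iff)
  \<comment> \<open>The open box gives positive volume; the closed box gives the finiteness that
    monotonicity of \<open>measure\<close> requires.\<close>
  have sub: "box a b \<subseteq> half_open_box a b" "half_open_box a b \<subseteq> cbox a b"
    by (auto simp: half_open_box_def box_def cbox_def intro: less_imp_le)
  have "half_open_box a b \<in> sets borel"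
    unfolding half_open_box_def by measurable
  hence "half_open_box a b \<in> fmeasurable lborel"
    using fmeasurableI2[OF fmeasurable_cbox sub(2)] by simp
  hence "measure lborel (box a b) \<le> measure lborel (half_open_box a b)"
    using sub(1) by (intro measure_mono_fmeasurable) auto
  moreover have "0 < measure lborel (box a b)"
    using ab by (subst measure_lborel_box) (auto intro!: prod_pos simp: inner_diff_left less_imp_le)
  ultimately show False using zero by simp
qed

lemma not_dense_if_empty_rectangle:
  fixes a b c d :: real and y :: "nat \<Rightarrow> real \<times> real"
  assumes "0 \<le> a" "a < b" "b \<le> 1" "0 \<le> c" "c < d" "d \<le> 1"
    and empty: "\<And>n. y n \<notin> {a..<b} \<times> {c..<d}"
  shows "\<not> {0..1} \<times> {0..1} \<subseteq> closure (range y)"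
proof
  assume sub: "{0..1} \<times> {0..1} \<subseteq> closure (range y)"
  have "y n \<notin> {a<..<b} \<times> {c<..<d}" for n
    using empty[of n] by (auto simp: mem_Times_iff)
  hence "({a<..<b} \<times> {c<..<d}) \<inter> range y = {}" unfolding disjoint_iff by (metis rangeE)
  moreover have "open ({a<..<b} \<times> {c<..<d})" by (intro open_Times) auto
  ultimately have "({a<..<b} \<times> {c<..<d}) \<inter> closure (range y) = {}"
    by (simp only: open_Int_closure_eq_empty)
  moreover have "((a + b) / 2, (c + d) / 2) \<in> closure (range y)"
    using assms by (intro subsetD[OF sub]) auto
  moreover have "((a + b) / 2, (c + d) / 2) \<in> {a<..<b} \<times> {c<..<d}"
    using assms by auto
  ultimately show False by blast
qed

section \<open>The rectangle avoided by the sequence\<close>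

text \<open>Scaling the two approximations by q and p makes their N-dependent terms equal;
  subtracting leaves p \<gamma> closer to an integer than its irrationality allows.\<close>

lemma empty_rectangle:
  assumes "ls_params L1 S1" "ls_params L2 S2"
    and rat: "ls_beta L1 S1 ^ k / ls_beta L2 S2 ^ Suc m \<in> \<rat>"
  obtains n n' where "\<And>N. ls_point L1 S1 N < ls_beta L1 S1 ^ n \<Longrightarrow>
     ls_beta L2 S2 \<le> ls_point L2 S2 N \<Longrightarrow>
     ls_point L2 S2 N < ls_beta L2 S2 + ls_beta L2 S2 ^ n' \<Longrightarrow> False"
proof -
  interpret A: ls_params L1 S1 by fact
  interpret B: ls_params L2 S2 by fact
  define \<gamma> where "\<gamma> = B.\<beta> ^ Suc m"
  have \<gamma>: "0 < \<gamma>" "\<gamma> \<notin> \<rat>"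
    using B.beta_pos B.beta_power_irrational by (simp_all add: \<gamma>_def)
  obtain p q :: int where q: "0 < q" and pq: "A.\<beta> ^ k / \<gamma> = of_int p / of_int q"
    using rat unfolding \<gamma>_def by (rule Rats_cases')
  have "0 < A.\<beta> ^ k / \<gamma>" using A.beta_pos \<gamma> by simp
  hence p: "0 < p" using q by (simp add: pq zero_less_divide_iff)
  have rel: "of_int q * A.\<beta> ^ k = of_int p * \<gamma>" using pq q \<gamma> by (simp add: field_simps)
  have "of_int p * \<gamma> \<notin> \<rat>"
  proof
    assume "of_int p * \<gamma> \<in> \<rat>"
    hence "of_int p * \<gamma> / of_int p \<in> \<rat>" by (intro Rats_divide) auto
    thus False using p \<gamma> by simp
  qed
  then obtain d where d: "0 < d" "\<And>z::int. d \<le> \<bar>of_int p * \<gamma> - of_int z\<bar>"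
    by (blast dest: irrational_dist_Ints)
  \<comment> \<open>The tolerances become d/2 each after scaling by q and p.\<close>
  obtain n where n: "\<And>N. A.\<xi> N < A.\<beta> ^ n \<Longrightarrow>
      \<exists>z::int. \<bar>real N * A.\<beta> ^ k - of_int z\<bar> < d / (2 * of_int q)"
    using A.near_0[of "d / (2 * of_int q)" k] d(1) q by auto
  obtain n' where n': "\<And>N. B.\<beta> \<le> B.\<xi> N \<Longrightarrow> B.\<xi> N < B.\<beta> + B.\<beta> ^ n' \<Longrightarrow>
      \<exists>z::int. \<bar>real N * \<gamma> - \<gamma> - of_int z\<bar> < d / (2 * of_int p)"
    using B.near_beta[of "d / (2 * of_int p)" "Suc m"] d(1) p unfolding \<gamma>_def by auto
  show thesis
  proof (rule that)
    fix N
    assume N: "A.\<xi> N < A.\<beta> ^ n" "B.\<beta> \<le> B.\<xi> N" "B.\<xi> N < B.\<beta> + B.\<beta> ^ n'"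
    obtain z z' :: int where z: "\<bar>real N * A.\<beta> ^ k - of_int z\<bar> < d / (2 * of_int q)"
      and z': "\<bar>real N * \<gamma> - \<gamma> - of_int z'\<bar> < d / (2 * of_int p)"
      using n[OF N(1)] n'[OF N(2,3)] by blast
    have "\<bar>of_int q * (real N * A.\<beta> ^ k - of_int z)\<bar> < d / 2"
      using mult_strict_left_mono[OF z, of "of_int q"] q by (simp add: abs_mult)
    moreover have "\<bar>of_int p * (real N * \<gamma> - \<gamma> - of_int z')\<bar> < d / 2"
      using mult_strict_left_mono[OF z', of "of_int p"] p by (simp add: abs_mult)
    moreover have "of_int p * \<gamma> - of_int (q * z - p * z') =
        of_int q * (real N * A.\<beta> ^ k - of_int z) - of_int p * (real N * \<gamma> - \<gamma> - of_int z')"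
      using arg_cong[OF rel, of "\<lambda>u. real N * u"] by (auto simp: algebra_simps)
    ultimately show False using d(2)[of "q * z - p * z'"] by linarith
  qed
qed

theorem theorem1:
  fixes L1 S1 L2 S2 :: nat
  assumes "int L1 > int S1 - 1" and "int S1 - 1 \<ge> 0"
    and "int L2 > int S2 - 1" and "int S2 - 1 \<ge> 0"
    and "\<exists>k m :: nat. ls_beta L1 S1 ^ (k + 1) / ls_beta L2 S2 ^ (m + 1) \<in> \<rat>"
  shows "\<not> uniformly_distributed_mod1 (\<lambda>n. (ls_point L1 S1 n, ls_point L2 S2 n))
    \<and> \<not> {0..1} \<times> {0..1} \<subseteq> closure (range (\<lambda>n. (ls_point L1 S1 n, ls_point L2 S2 n)))"
proof -
  interpret A: ls_params L1 S1 using assms by unfold_locales linarith+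
  interpret B: ls_params L2 S2 using assms by unfold_locales linarith+
  obtain k m where "A.\<beta> ^ Suc k / B.\<beta> ^ Suc m \<in> \<rat>" using assms(5) by auto
  then obtain n n' where empty: "\<And>N. A.\<xi> N < A.\<beta> ^ n \<Longrightarrow> B.\<beta> \<le> B.\<xi> N \<Longrightarrow>
      B.\<xi> N < B.\<beta> + B.\<beta> ^ n' \<Longrightarrow> False"
    using empty_rectangle[OF A.ls_params_axioms B.ls_params_axioms] by blast
  define b where "b = A.\<beta> ^ n"
  \<comment> \<open>The cut at 1 keeps the box in the unit square; it stays nondegenerate since
    \<open>B.\<beta>\<close> < 1.\<close>
  define d where "d = min 1 (B.\<beta> + B.\<beta> ^ n')"
  have bd: "0 < b" "b \<le> 1" "0 \<le> B.\<beta>" "B.\<beta> < d" "d \<le> 1"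
    using A.beta_pos A.beta_power_antimono[of 0 n] B.beta_pos B.beta_less_1
    by (auto simp: b_def d_def)
  have notin: "(A.\<xi> N, B.\<xi> N) \<notin> {0..<b} \<times> {B.\<beta>..<d}" for N
    using empty[of N] by (auto simp: b_def d_def)
  have "\<not> uniformly_distributed_mod1 (\<lambda>n. (A.\<xi> n, B.\<xi> n))"
    by (rule not_uniformly_distributed_mod1_if_empty_box[of "(0, B.\<beta>)" "(b, d)"])
      (use bd notin in \<open>auto simp: half_open_box_prod Basis_prod_def\<close>)
  moreover have "\<not> {0..1} \<times> {0..1} \<subseteq> closure (range (\<lambda>n. (A.\<xi> n, B.\<xi> n)))"
    by (rule not_dense_if_empty_rectangle[of 0 b B.\<beta> d]) (use bd notin in auto)
  ultimately show ?thesis by blast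
qed

end
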